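(* Let $G$ be a graph with exactly two connected components and let $k\ge 3$ be an integer. Then $(G,k)$ is niche-realizable if and only if $k=3$ and $G$ is isomorphic to an expansion of $P_3 \cup K_1$.
   Context: All graphs are simple; $P_3$ is the path on $3$ vertices and $P_3\cup K_1$ is its disjoint union with an isolated vertex. A $k$-partite tournament is an orientation of a complete $k$-partite graph with $k$ nonempty partite sets. The niche graph $\mathcal{N}(D)$ of a digraph $D$ has vertex set $V(D)$, and two distinct vertices $u,v$ are adjacent iff they have a common out-neighbor in $D$ or a common in-neighbor in $D$. The pair $(G,k)$ is niche-realizable if $G$ is isomorphic to the niche graph of some $k$-partite tournament. Replacing a vertex $v$ of a graph $H$ by a clique on a finite nonempty set $K$ disjoint from $V(H)$ gives the graph with vertex set $(V(H)\cup K)\setminus\{v\}$ and edge set $E(H-v)\cup\{wx : w\ne x,\ w,x\in K\}\cup\{uw : uv\in E(H),\ w\in K\}$. An expansion of $H$ is a graph obtained by replacing each vertex of $H$ by a clique (possibly of size $1$). *)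

theory Defs
  imports
    "HOL-Library.Disjoint_Sets"
    "Graph_Theory.Pair_Digraph"
    "Graph_Theory.Digraph_Component"
    "Graph_Theory.Digraph_Isomorphism"
begin

text \<open>
  A finite simple graph is a \<^locale>\<open>pair_graph\<close>: a finite, loopfree, symmetric set of pairs, where
  the edge \<open>uv\<close> is represented by the two arcs \<open>(u, v)\<close> and \<open>(v, u)\<close>. Digraphs live on the same
  record type, so that \<^const>\<open>digraph_iso\<close> is isomorphism for both; on pair digraphs it is
  isomorphism in the usual sense, see \<open>digraph_iso_pair_iff\<close>.
\<close>

lemma digraph_iso_pair_iff:
  assumes "pair_wf_digraph G" "pair_wf_digraph H"
  shows "digraph_iso (with_proj G) (with_proj H) \<longleftrightarrow>
    (\<exists>f. bij_betw f (pverts G) (pverts H) \<and>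
         (\<forall>u\<in>pverts G. \<forall>v\<in>pverts G. (u, v) \<in> parcs G \<longleftrightarrow> (f u, f v) \<in> parcs H))"
    (is "?L \<longleftrightarrow> ?R")
proof
  interpret G: pair_wf_digraph G by fact
  interpret H: pair_wf_digraph H by fact
  {
    assume ?L
    then obtain h where
      h: "pre_digraph.digraph_isomorphism (with_proj G) h" and H: "with_proj H = app_iso h (with_proj G)"
      unfolding digraph_iso_def by blast
    have V: "pverts H = iso_verts h ` pverts G" and A: "parcs H = iso_arcs h ` parcs G"
      and ends: "iso_tail h = fst" "iso_head h = snd"
      using arg_cong[OF H, of verts] arg_cong[OF H, of arcs]
        arg_cong[OF H, of tail] arg_cong[OF H, of head] by auto
    have inj: "inj_on (iso_verts h) (pverts G)"
      and arc: "\<And>u v. (u, v) \<in> parcs G \<Longrightarrow> iso_arcs h (u, v) = (iso_verts h u, iso_verts h v)"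
      using h unfolding pre_digraph.digraph_isomorphism_def by (auto simp: ends prod_eq_iff)
    have "(u, v) \<in> parcs G \<longleftrightarrow> (iso_verts h u, iso_verts h v) \<in> parcs H"
      if uv: "u \<in> pverts G" "v \<in> pverts G" for u v
    proof
      assume "(u, v) \<in> parcs G"
      then show "(iso_verts h u, iso_verts h v) \<in> parcs H"
        unfolding A by (rule rev_image_eqI) (simp add: arc \<open>(u, v) \<in> parcs G\<close>)
    next
      assume "(iso_verts h u, iso_verts h v) \<in> parcs H"
      then obtain x y where xy: "(x, y) \<in> parcs G" "(iso_verts h u, iso_verts h v) = iso_arcs h (x, y)"
        by (auto simp: A)
      then have "iso_verts h x = iso_verts h u" "iso_verts h y = iso_verts h v"
        using arc by auto
      then have "x = u" "y = v"
        using inj uv G.wellformed'[OF xy(1)] by (auto dest: inj_onD)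
      with xy show "(u, v) \<in> parcs G" by simp
    qed
    then show ?R
      using inj V by (auto simp: bij_betw_def intro!: exI[of _ "iso_verts h"])
  next
    assume ?R
    then obtain f where f: "inj_on f (pverts G)" "f ` pverts G = pverts H"
      and fa: "\<And>u v. u \<in> pverts G \<Longrightarrow> v \<in> pverts G \<Longrightarrow> (u, v) \<in> parcs G \<longleftrightarrow> (f u, f v) \<in> parcs H"
      by (auto simp: bij_betw_def)
    define h where "h = \<lparr> iso_verts = f, iso_arcs = map_prod f f, iso_head = snd, iso_tail = fst \<rparr>"
    have "inj_on (map_prod f f) (parcs G)"
      by (rule inj_on_subset[OF map_prod_inj_on[OF f(1) f(1)]]) (auto dest: G.wellformed')
    then have "pre_digraph.digraph_isomorphism (with_proj G) h"
      using f G.wf_digraph unfolding pre_digraph.digraph_isomorphism_def by (simp add: h_def)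
    moreover have "map_prod f f ` parcs G = parcs H"
    proof (intro equalityI subsetI)
      fix e assume "e \<in> map_prod f f ` parcs G"
      then obtain x y where "(x, y) \<in> parcs G" "e = (f x, f y)" by auto
      then show "e \<in> parcs H" using fa[of x y] G.wellformed'[of x y] by simp
    next
      fix e assume e: "e \<in> parcs H"
      then obtain a b where ab: "e = (a, b)" "a \<in> pverts H" "b \<in> pverts H"
        using H.wellformed' by (cases e) auto
      then obtain x y where "x \<in> pverts G" "y \<in> pverts G" "a = f x" "b = f y"
        unfolding f(2)[symmetric] by auto
      then have "(x, y) \<in> parcs G" "e = map_prod f f (x, y)" using fa e ab by auto
      then show "e \<in> map_prod f f ` parcs G" by (rule rev_image_eqI)
    qed
    then have "with_proj H = app_iso h (with_proj G)"
      using f by (simp add: app_iso_def h_def with_proj_def)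
    ultimately show ?L unfolding digraph_iso_def by blast
  }
qed

definition components :: "'a pair_pre_digraph \<Rightarrow> ('a, 'a \<times> 'a) pre_digraph set" where
  "components G = {C. pre_digraph.max_subgraph (with_proj G) connected C}"

definition complete_partite :: "nat \<Rightarrow> 'a pair_pre_digraph \<Rightarrow> bool" where
  "complete_partite k H \<longleftrightarrow> pair_graph H \<and>
    (\<exists>P. partition_on (pverts H) P \<and> card P = k \<and>
      parcs H = {(u, v). u \<in> pverts H \<and> v \<in> pverts H \<and> \<not> (\<exists>X\<in>P. u \<in> X \<and> v \<in> X)})"

definition orientation_of :: "'a pair_pre_digraph \<Rightarrow> 'a pair_pre_digraph \<Rightarrow> bool" where
  "orientation_of D H \<longleftrightarrow> pverts D = pverts H \<and> parcs D \<subseteq> parcs H \<and>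
    (\<forall>(u, v)\<in>parcs H. (u, v) \<in> parcs D \<longleftrightarrow> (v, u) \<notin> parcs D)"

definition partite_tournament :: "nat \<Rightarrow> 'a pair_pre_digraph \<Rightarrow> bool" where
  "partite_tournament k D \<longleftrightarrow> (\<exists>H. complete_partite k H \<and> orientation_of D H)"

definition niche_graph :: "'a pair_pre_digraph \<Rightarrow> 'a pair_pre_digraph" where
  "niche_graph D = \<lparr> pverts = pverts D,
    parcs = {(u, v). u \<in> pverts D \<and> v \<in> pverts D \<and> u \<noteq> v \<and>
      ((\<exists>w\<in>pverts D. (u, w) \<in> parcs D \<and> (v, w) \<in> parcs D) \<or>
       (\<exists>w\<in>pverts D. (w, u) \<in> parcs D \<and> (w, v) \<in> parcs D))} \<rparr>"

text \<open>
  A definition cannot quantify over the vertex type of the tournament. Taking \<^typ>\<open>nat\<close> loses nothing,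
  as every finite digraph has an isomorphic copy on a set of natural numbers.
\<close>

definition niche_realizable :: "'a pair_pre_digraph \<Rightarrow> nat \<Rightarrow> bool" where
  "niche_realizable G k \<longleftrightarrow>
    (\<exists>D :: nat pair_pre_digraph. partite_tournament k D \<and>
      digraph_iso (with_proj G) (with_proj (niche_graph D)))"

definition replace_by_clique :: "'a pair_pre_digraph \<Rightarrow> 'a \<Rightarrow> 'a set \<Rightarrow> 'a pair_pre_digraph" where
  "replace_by_clique H v K = \<lparr> pverts = (pverts H \<union> K) - {v},
    parcs = {(x, y). (x, y) \<in> parcs H \<and> x \<noteq> v \<and> y \<noteq> v}
      \<union> {(w, x). w \<in> K \<and> x \<in> K \<and> w \<noteq> x}
      \<union> {(u, w). (u, v) \<in> parcs H \<and> w \<in> K}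
      \<union> {(w, u). (u, v) \<in> parcs H \<and> w \<in> K} \<rparr>"

text \<open>
  \<open>expands H S G\<close>: the graph \<open>G\<close> arises from \<open>H\<close> by replacing the vertices in \<open>S\<close>, one after the
  other and each exactly once, by cliques. Each clique is disjoint from the graph at the time of the
  replacement, so it never meets the vertices that still have to be replaced.
\<close>

inductive expands :: "'a pair_pre_digraph \<Rightarrow> 'a set \<Rightarrow> 'a pair_pre_digraph \<Rightarrow> bool" where
  expands_none: "expands H {} H"
| expands_replace: "\<lbrakk> v \<in> S; v \<in> pverts H; finite K; K \<noteq> {}; K \<inter> pverts H = {};
      expands (replace_by_clique H v K) (S - {v}) G \<rbrakk> \<Longrightarrow> expands H S G"

definition expansion_of :: "'a pair_pre_digraph \<Rightarrow> 'a pair_pre_digraph \<Rightarrow> bool" where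
  "expansion_of E H \<longleftrightarrow> expands H (pverts H) E"

text \<open>The path \<open>0 - 1 - 2\<close> together with the isolated vertex \<open>3\<close>.\<close>

definition P3_union_K1 :: "nat pair_pre_digraph" where
  "P3_union_K1 = \<lparr> pverts = {0, 1, 2, 3}, parcs = {(0, 1), (1, 0), (1, 2), (2, 1)} \<rparr>"

end

theory Submission
  imports Defs
begin

text \<open>
  Colour the vertices by the two components of the niche graph of a \<open>k\<close>-partite tournament \<open>D\<close>.
  In- and out-neighbourhoods are monochromatic, so a vertex that sees both colours outside its part
  receives all arcs from one colour and sends all arcs to the other. Three vertices in distinct parts
  cannot all be of this kind, so some part \<open>X\<close> contains a whole colour class \<open>W\<close>. Every vertex
  outside \<open>X\<close> then sees both colours, so there are only two further parts \<open>Y\<close> and \<open>Z\<close>, whose vertices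
  have opposite types. This forces \<open>Y \<rightarrow> Z \<rightarrow> W \<rightarrow> Y\<close> and \<open>Y \<rightarrow> X - W \<rightarrow> Z\<close>, up to exchanging \<open>Y\<close>
  and \<open>Z\<close>. The niche graph of this tournament is the expansion of \<open>P\<^sub>3 \<union> K\<^sub>1\<close> with path
  \<open>Y, X - W, Z\<close> and isolated clique \<open>W\<close>; it has three components if \<open>X = W\<close>.
\<close>

subsection \<open>Components of symmetric digraphs\<close>

lemma strongly_connected_imp_connected:
  assumes "strongly_connected G"
  shows "connected G"
  unfolding connected_conv
proof (intro conjI ballI)
  show "verts G \<noteq> {}" using assms by (simp add: strongly_connected_def)
  fix u v assume "u \<in> verts G" "v \<in> verts G"
  then have "u \<rightarrow>\<^sup>*\<^bsub>G\<^esub> v" using assms by (simp add: strongly_connected_def)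
  then show "(u, v) \<in> rtrancl_on (verts G) ((arcs_ends G)\<^sup>s)"
    unfolding reachable_def by (elim rtrancl_on_mono[rotated -1]) (auto simp: symcl_def)
qed

text \<open>Additional arcs on the same vertices cannot disconnect a digraph. This is what makes
  every maximal connected subgraph an induced one.\<close>

lemma arc_mono_connected: "arc_mono connected"
  unfolding arc_mono_def
proof (intro allI impI)
  fix H1 H2 :: "('a, 'b) pre_digraph"
  assume *: "connected H1 \<and> subgraph H1 H2 \<and> verts H1 = verts H2"
  then have "wf_digraph H2" by (simp add: subgraph_def)
  then show "connected H2"
    using * by (intro wf_digraph.connected_spanning_imp_connected[of H2 H1]) (auto simp: spanning_def)
qed

text \<open>Induced subgraphs inherit symmetry, and in a symmetric digraph an undirected path can be
  walked along arcs in both directions.\<close>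

lemma (in sym_digraph) induced_connected_iff_strongly_connected:
  assumes "induced_subgraph H G"
  shows "connected H \<longleftrightarrow> strongly_connected H"
proof -
  interpret H: sym_digraph H using assms by (rule induced_graph_imp_graph)
  show ?thesis
    using H.symmetric_connected_imp_strongly_connected H.sym_arcs strongly_connected_imp_connected
    by blast
qed

text \<open>A maximal connected subgraph is induced, hence symmetric, hence strongly connected. This
  identifies the components with the strongly connected components, so that the theory of
  \<open>sccs\<close> and \<open>scc_of\<close> applies.\<close>

lemma (in sym_digraph) max_connected_subgraphs_eq_sccs:
  "{C. max_subgraph connected C} = sccs"
proof (intro equalityI subsetI)
  fix C assume "C \<in> {C. max_subgraph connected C}"
  then have C: "max_subgraph connected C" by simp
  then have "induced_subgraph C G" by (rule induced_subgraphI_arc_mono) (rule arc_mono_connected)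
  moreover have "connected C" using C by (rule max_subgraph_prop)
  ultimately have "strongly_connected C" by (simp add: induced_connected_iff_strongly_connected)
  with C show "C \<in> sccs"
    unfolding sccs_altdef2 using max_subgraph_mp strongly_connected_imp_connected by blast
next
  fix C assume C: "C \<in> sccs"
  then have ms: "max_subgraph strongly_connected C" by (simp add: sccs_altdef2)
  then have sub: "subgraph C G" and sc: "strongly_connected C"
    by (auto simp: max_subgraph_def)
  have "\<not> connected H" if H: "C \<noteq> H" "subgraph C H" "subgraph H G" for H
  proof
    assume con: "connected H"
    \<comment> \<open>\<open>H\<close> itself may lack reverse arcs, so connectedness need not give
      strong connectedness. The subgraph induced on its vertices is still connected, and it is
      symmetric.\<close>
    let ?H = "G \<restriction> verts H"
    have HH: "subgraph H ?H" using H(3) by (rule subgraph_induce_subgraphI2)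
    have ind: "induced_subgraph ?H G" using H(3) by (auto dest: subgraph_imp_subverts)
    have "connected ?H" 
      by (rule arc_mono_connected[unfolded arc_mono_def, rule_format]) (use con HH in auto)
    then have "strongly_connected ?H" by (simp add: induced_connected_iff_strongly_connected[OF ind])
    moreover have "subgraph C ?H" using H(2) HH by (rule subgraph_trans)
    moreover have "subgraph ?H G" using ind by (rule induced_imp_subgraph)
    ultimately have "?H = C" using ms by (auto simp: max_subgraph_def)
    with HH have "subgraph H C" by simp
    with H(2) have "C = H" by (auto simp: subgraph_def compatible_def)
    with H(1) show False by simp
  qed
  then have "max_subgraph connected C"
    using sub strongly_connected_imp_connected[OF sc] by (intro max_subgraphI)
  then show "C \<in> {C. max_subgraph connected C}" by simp
qed

lemma components_eq_sccs:
  assumes "pair_graph G"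
  shows "components G = pre_digraph.sccs (with_proj G)"
proof -
  interpret pair_graph G by fact
  show ?thesis unfolding components_def by (rule max_connected_subgraphs_eq_sccs)
qed

lemma card_components_eq_card_sccs_verts:
  assumes "pair_graph G"
  shows "card (components G) = card (pre_digraph.sccs_verts (with_proj G))"
proof -
  interpret pair_graph G by fact
  show ?thesis unfolding components_eq_sccs[OF assms] by (rule card_sccs_verts[symmetric])
qed

lemma card_components_iso:
  assumes "pair_graph G" "pair_graph H" "digraph_iso (with_proj G) (with_proj H)"
  shows "card (components H) = card (components G)"
proof -
  interpret pair_graph G by fact
  obtain h where h: "digraph_isomorphism h" and H: "with_proj H = app_iso h (with_proj G)"
    using assms(3) unfolding digraph_iso_def by blast
  show ?thesis
    unfolding components_eq_sccs[OF assms(1)] components_eq_sccs[OF assms(2)] H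
    using h by simp
qed

text \<open>This supplies the colouring: \<open>U\<close> and \<open>W\<close> are the vertex sets
  of the two components. An arc and its reverse make the two ends mutually reachable, so no arc
  leaves a component.\<close>

lemma two_components_split:
  assumes "pair_graph G" "card (components G) = 2"
  obtains U W where "U \<union> W = pverts G" "U \<inter> W = {}" "U \<noteq> {}" "W \<noteq> {}"
    "\<And>u v. (u, v) \<in> parcs G \<Longrightarrow> u \<in> U \<longleftrightarrow> v \<in> U"
proof -
  interpret pair_graph G by fact
  obtain U W where UW: "sccs_verts = {U, W}" "U \<noteq> W"
    using assms(2) unfolding card_components_eq_card_sccs_verts[OF assms(1)] by (auto simp: card_2_iff)
  have 1: "U \<union> W = pverts G"
  proof
    show "U \<union> W \<subseteq> pverts G" using sccs_verts_subsets UW by auto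
    show "pverts G \<subseteq> U \<union> W"
    proof
      fix v assume "v \<in> pverts G"
      then have "scc_of v \<in> sccs_verts" "v \<in> scc_of v"
        by (auto intro: scc_of_in_sccs_verts in_scc_of_self)
      then show "v \<in> U \<union> W" using UW by auto
    qed
  qed
  have 2: "U \<inter> W = {}" using sccs_verts_disjoint UW by auto
  have U: "U \<in> sccs_verts" and W: "W \<in> sccs_verts" using UW by auto
  then have 3: "U \<noteq> {}" "W \<noteq> {}" by (auto simp: in_sccs_verts_conv_reachable)
  have "v \<in> U" if "(u, v) \<in> parcs G" "u \<in> U" for u v
  proof (rule ccontr)
    assume "v \<notin> U"
    moreover have "u \<rightarrow>\<^sup>*\<^bsub>with_proj G\<^esub> v" "v \<rightarrow>\<^sup>*\<^bsub>with_proj G\<^esub> u" using that(1) graph_symmetric by auto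
    ultimately show False using U that(2) unfolding in_sccs_verts_conv_reachable by blast
  qed
  then have 4: "u \<in> U \<longleftrightarrow> v \<in> U" if "(u, v) \<in> parcs G" for u v
    using that graph_symmetric by blast
  show thesis using that 1 2 3 4 by blast
qed

text \<open>A class closed under adjacency contains the whole component of each of its vertices, so
  distinct classes contain distinct components.\<close>

lemma card_closed_partition_le:
  assumes "pair_graph G" "partition_on (pverts G) P"
    and closed: "\<And>X u v. X \<in> P \<Longrightarrow> (u, v) \<in> parcs G \<Longrightarrow> u \<in> X \<Longrightarrow> v \<in> X"
  shows "card P \<le> card (components G)"
proof -
  interpret pair_graph G by fact
  have P: "\<Union>P = pverts G" "{} \<notin> P" "disjoint P" using assms(2) by (auto simp: partition_on_def)
  \<comment> \<open>The component of an arbitrary representative: it is nonempty and stays inside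
    \<open>X\<close>, and the classes are disjoint, so \<open>f\<close> is injective on
    \<open>P\<close>.\<close>
  define f where "f X = scc_of (SOME x. x \<in> X)" for X
  have some: "(SOME x. x \<in> X) \<in> X" if "X \<in> P" for X using that P(2) by (metis some_in_eq)
  have reach: "v \<in> X" if "u \<rightarrow>\<^sup>*\<^bsub>with_proj G\<^esub> v" "X \<in> P" "u \<in> X" for u v X
    using that(1,3) by (induction rule: reachable_induct) (use closed[OF \<open>X \<in> P\<close>] in auto)
  have f: "f X \<subseteq> X" "f X \<in> sccs_verts" if "X \<in> P" for X
  proof -
    show "f X \<subseteq> X" using reach that some[OF that] by (auto simp: f_def scc_of_def)
    show "f X \<in> sccs_verts" unfolding f_def using some[OF that] that P(1)
      by (intro scc_of_in_sccs_verts) auto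
  qed
  have "f X \<noteq> {}" if "X \<in> P" for X using f(2)[OF that] by (auto simp: in_sccs_verts_conv_reachable)
  then have "inj_on f P"
  proof (intro inj_onI)
    fix X Y assume *: "X \<in> P" "Y \<in> P" "f X = f Y" and ne: "\<And>X. X \<in> P \<Longrightarrow> f X \<noteq> {}"
    then have "X \<inter> Y \<noteq> {}" using f(1)[of X] f(1)[of Y] by blast
    then show "X = Y" using * P(3) by (auto simp: disjoint_def)
  qed
  then have "card P \<le> card sccs_verts" by (rule card_inj_on_le) (use f finite_sccs_verts in auto)
  then show ?thesis by (simp add: card_components_eq_card_sccs_verts[OF assms(1)])
qed

subsection \<open>Expansions\<close>

text \<open>The expansion described in one step: all vertices are replaced simultaneously, so no
  order of replacement enters, unlike in \<open>expands\<close>.\<close>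

definition blow_up :: "'a pair_pre_digraph \<Rightarrow> ('a \<Rightarrow> 'b set) \<Rightarrow> 'b pair_pre_digraph" where
  "blow_up H F = \<lparr> pverts = (\<Union>v\<in>pverts H. F v),
    parcs = {(x, y). x \<noteq> y \<and> (\<exists>u\<in>pverts H. \<exists>v\<in>pverts H.
      x \<in> F u \<and> y \<in> F v \<and> (u = v \<or> (u, v) \<in> parcs H))} \<rparr>"

lemma blow_upI:
  assumes "a \<in> pverts H" "b \<in> pverts H" "x \<in> F a" "y \<in> F b" "x \<noteq> y" "a = b \<or> (a, b) \<in> parcs H"
  shows "(x, y) \<in> parcs (blow_up H F)"
  using assms unfolding blow_up_def by simp blast

lemma blow_upE:
  assumes "(x, y) \<in> parcs (blow_up H F)"
  obtains a b where "x \<noteq> y" "a \<in> pverts H" "b \<in> pverts H" "x \<in> F a" "y \<in> F b"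
    "a = b \<or> (a, b) \<in> parcs H"
  using assms unfolding blow_up_def by auto

lemma blow_up_singletons:
  assumes "pair_graph H"
  shows "blow_up H (\<lambda>v. {v}) = H"
proof -
  interpret pair_graph H by fact
  have "parcs (blow_up H (\<lambda>v. {v})) = parcs H"
    using pair_no_loops wellformed' by (fastforce simp: blow_up_def)
  then show ?thesis by (intro pair_pre_digraph.equality) (auto simp: blow_up_def)
qed

lemma blow_up_cong:
  assumes "\<And>v. v \<in> pverts H \<Longrightarrow> F v = F' v"
  shows "blow_up H F = blow_up H F'"
  using assms by (auto simp: blow_up_def)

text \<open>The equation \<open>F v = {v}\<close> says that \<open>v\<close> has not been replaced
  yet. By disjointness \<open>v\<close> then lies in no other \<open>F u\<close>, so the neighbours
  of \<open>v\<close> in the blow-up are exactly the members of the cliques of its neighbours in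
  \<open>H\<close>.\<close>

lemma replace_by_clique_blow_up:
  assumes "pair_graph H" "v \<in> pverts H" "F v = {v}" "disjoint_family_on F (pverts H)"
    and K: "K \<inter> pverts (blow_up H F) = {}"
  shows "replace_by_clique (blow_up H F) v K = blow_up H (F(v := K))"
proof -
  interpret pair_graph H by fact
  have sym: "(a, b) \<in> parcs H \<longleftrightarrow> (b, a) \<in> parcs H" for a b using graph_symmetric by blast
  have Fv: "v \<in> F u \<longleftrightarrow> u = v" if "u \<in> pverts H" for u
    using assms(2,3,4) that by (auto simp: disjoint_family_on_def)
  have vK: "v \<notin> K" and KF: "u \<in> pverts H \<Longrightarrow> x \<in> K \<Longrightarrow> x \<notin> F u" for u x
    using K assms(2,3) by (auto simp: blow_up_def)
  have V: "pverts (replace_by_clique (blow_up H F) v K) = pverts (blow_up H (F(v := K)))"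
  proof (rule set_eqI)
    fix x
    show "x \<in> pverts (replace_by_clique (blow_up H F) v K) \<longleftrightarrow> x \<in> pverts (blow_up H (F(v := K)))"
    proof (cases "x = v")
      case True
      then have "x \<notin> pverts (replace_by_clique (blow_up H F) v K)"
        by (simp add: replace_by_clique_def)
      moreover have "x \<notin> (F(v := K)) u" if "u \<in> pverts H" for u
        using True that Fv[of u] vK by simp
      then have "x \<notin> pverts (blow_up H (F(v := K)))"
        unfolding blow_up_def pair_pre_digraph.simps by blast
      ultimately show ?thesis by simp
    next
      case False
      have "x \<in> pverts (replace_by_clique (blow_up H F) v K) \<longleftrightarrow> x \<in> K \<or> (\<exists>u\<in>pverts H - {v}. x \<in> F u)"
        using False assms(2,3) by (auto simp: replace_by_clique_def blow_up_def)
      moreover have "x \<in> pverts (blow_up H (F(v := K))) \<longleftrightarrow> x \<in> K \<or> (\<exists>u\<in>pverts H - {v}. x \<in> F u)"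
        using assms(2) by (auto simp: blow_up_def)
      ultimately show ?thesis by blast
    qed
  qed
  have A: "(x, y) \<in> parcs (replace_by_clique (blow_up H F) v K) \<longleftrightarrow> (x, y) \<in> parcs (blow_up H (F(v := K)))"
    (is "?L \<longleftrightarrow> ?R") for x y
  proof
    assume ?L
    then consider (old) "(x, y) \<in> parcs (blow_up H F)" "x \<noteq> v" "y \<noteq> v"
      | (new) "x \<in> K" "y \<in> K" "x \<noteq> y"
      | (l) "(x, v) \<in> parcs (blow_up H F)" "y \<in> K"
      | (r) "(y, v) \<in> parcs (blow_up H F)" "x \<in> K"
      by (auto simp: replace_by_clique_def)
    then show ?R
    proof cases
      case old
      from old(1) obtain a b where ab: "x \<noteq> y" "a \<in> pverts H" "b \<in> pverts H" "x \<in> F a" "y \<in> F b"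
        "a = b \<or> (a, b) \<in> parcs H" by (rule blow_upE)
      then have "a \<noteq> v" "b \<noteq> v" using old assms(3) by auto
      then show ?thesis using ab by (intro blow_upI[of a _ b]) auto
    next
      case new
      then show ?thesis using assms(2) by (intro blow_upI[of v _ v]) auto
    next
      case l
      from l(1) obtain a b where "x \<noteq> v" "a \<in> pverts H" "b \<in> pverts H" "x \<in> F a" "v \<in> F b"
        "a = b \<or> (a, b) \<in> parcs H" by (rule blow_upE)
      then have a: "a \<in> pverts H" "x \<in> F a" "a = v \<or> (a, v) \<in> parcs H" "x \<noteq> v"
        using Fv[of b] by auto
      then have av: "a \<noteq> v" using assms(3) by auto
      have "x \<noteq> y" using KF l(2) a by auto
      then show ?thesis using a av l(2) assms(2) by (intro blow_upI[of a _ v]) auto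
    next
      case r
      from r(1) obtain a b where "y \<noteq> v" "a \<in> pverts H" "b \<in> pverts H" "y \<in> F a" "v \<in> F b"
        "a = b \<or> (a, b) \<in> parcs H" by (rule blow_upE)
      then have a: "a \<in> pverts H" "y \<in> F a" "a = v \<or> (a, v) \<in> parcs H" "y \<noteq> v"
        using Fv[of b] by auto
      then have av: "a \<noteq> v" using assms(3) by auto
      then have va: "(v, a) \<in> parcs H" using a sym by blast
      have "x \<noteq> y" using KF r(2) a by auto
      then show ?thesis using a av va r(2) assms(2) by (intro blow_upI[of v _ a]) auto
    qed
  next
    assume ?R
    then obtain a b where ab: "x \<noteq> y" "a \<in> pverts H" "b \<in> pverts H"
      "x \<in> (F(v := K)) a" "y \<in> (F(v := K)) b" "a = b \<or> (a, b) \<in> parcs H" by (rule blow_upE)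
    consider (both) "a = v" "b = v" | (left) "a = v" "b \<noteq> v" | (right) "a \<noteq> v" "b = v"
      | (none) "a \<noteq> v" "b \<noteq> v" by blast
    then show ?L
    proof cases
      case both
      then show ?thesis using ab by (simp add: replace_by_clique_def)
    next
      case left
      then have "(b, v) \<in> parcs H" "y \<in> F b" "x \<in> K" "y \<noteq> v" using ab sym Fv by auto
      then have "(y, v) \<in> parcs (blow_up H F)" using ab(3) assms(2,3) by (intro blow_upI[of b _ v]) auto
      then show ?thesis using \<open>x \<in> K\<close> by (simp add: replace_by_clique_def)
    next
      case right
      then have "(a, v) \<in> parcs H" "x \<in> F a" "y \<in> K" "x \<noteq> v" using ab Fv by auto
      then have "(x, v) \<in> parcs (blow_up H F)" using ab(2) assms(2,3) by (intro blow_upI[of a _ v]) auto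
      then show ?thesis using \<open>y \<in> K\<close> by (simp add: replace_by_clique_def)
    next
      case none
      then have "x \<in> F a" "y \<in> F b" "x \<noteq> v" "y \<noteq> v" using ab Fv by auto
      moreover from this have "(x, y) \<in> parcs (blow_up H F)" using ab by (intro blow_upI[of a _ b]) auto
      ultimately show ?thesis by (simp add: replace_by_clique_def)
    qed
  qed
  show ?thesis
    by (rule pair_pre_digraph.equality) (use V A in auto)
qed

definition clique_family :: "'a set \<Rightarrow> ('a \<Rightarrow> 'b set) \<Rightarrow> bool" where
  "clique_family V F \<longleftrightarrow> disjoint_family_on F V \<and> (\<forall>v\<in>V. finite (F v) \<and> F v \<noteq> {})"

lemma clique_family_upd:
  assumes "clique_family (pverts H) F" "finite K" "K \<noteq> {}" "K \<inter> pverts (blow_up H F) = {}"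
  shows "clique_family (pverts H) (F(v := K))"
  using assms unfolding clique_family_def disjoint_family_on_def blow_up_def by auto

lemma clique_family_image:
  assumes "clique_family V F" "inj f"
  shows "clique_family V (\<lambda>v. f ` F v)"
  using assms(1) unfolding clique_family_def disjoint_family_on_def
  by (simp add: image_Int[OF assms(2), symmetric])

text \<open>The invariant along a chain of replacements: the current graph is a blow-up of the
  original \<open>H\<close>, and the vertices in \<open>S\<close>, still to be replaced, stand for
  themselves.\<close>

lemma expands_blow_upD:
  assumes "expands H' S E" "H' = blow_up H F" "pair_graph H" "S \<subseteq> pverts H"
    "\<And>v. v \<in> S \<Longrightarrow> F v = {v}" "clique_family (pverts H) F"
  shows "\<exists>F'. E = blow_up H F' \<and> clique_family (pverts H) F'"
  using assms
proof (induction arbitrary: F rule: expands.induct)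
  case (expands_none H')
  then show ?case by blast
next
  case (expands_replace v S H' K E)
  have vH: "v \<in> pverts H" using expands_replace by auto
  have "replace_by_clique H' v K = blow_up H (F(v := K))"
    using expands_replace vH unfolding \<open>H' = _\<close>
    by (intro replace_by_clique_blow_up) (auto simp: clique_family_def)
  moreover have "clique_family (pverts H) (F(v := K))"
    using expands_replace by (intro clique_family_upd) auto
  ultimately show ?case
    using expands_replace.prems by (intro expands_replace.IH[of "F(v := K)"]) (auto simp del: fun_upd_apply simp: fun_upd_other)
qed

text \<open>\<open>F\<close> is the current stage and \<open>F'\<close> the goal; they agree outside
  the set \<open>S\<close> of pending vertices. The cliques of \<open>F'\<close> avoid
  \<open>pverts H\<close> because a new clique must miss the pending vertices, which are still
  present under their own names.\<close>

lemma expands_blow_upI: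
  assumes "finite S" "pair_graph H" "S \<subseteq> pverts H"
    "\<And>v. v \<in> S \<Longrightarrow> F v = {v}" "clique_family (pverts H) F" "clique_family (pverts H) F'"
    "\<And>v. v \<in> pverts H \<Longrightarrow> F' v \<inter> pverts H = {}"
    "\<And>v. v \<in> pverts H - S \<Longrightarrow> F v = F' v"
  shows "expands (blow_up H F) S (blow_up H F')"
  using assms
proof (induction arbitrary: F rule: finite_induct)
  case empty
  then have "blow_up H F = blow_up H F'" by (intro blow_up_cong) auto
  then show ?case by (simp add: expands_none)
next
  case (insert v S)
  have vH: "v \<in> pverts H" using insert by auto
  have v: "v \<in> pverts (blow_up H F)" using insert.prems(3)[of v] vH by (auto simp: blow_up_def)
  have K: "finite (F' v)" "F' v \<noteq> {}" using insert.prems(5) vH by (auto simp: clique_family_def)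
  \<comment> \<open>A pending \<open>u\<close> has \<open>F u = {u}\<close>, which the new clique
    avoids; any other \<open>u\<close> already has its final clique, and the final cliques are
    disjoint.\<close>
  have disj: "F' v \<inter> F u = {}" if u: "u \<in> pverts H" for u
  proof (cases "u \<in> insert v S")
    case True
    then show ?thesis using insert.prems(3)[of u] insert.prems(6)[OF vH] u by auto
  next
    case False
    then have "u \<noteq> v" "F u = F' u" using insert.prems(7)[of u] u by auto
    moreover have "disjoint_family_on F' (pverts H)"
      using insert.prems(5) by (simp add: clique_family_def)
    ultimately show ?thesis using u vH disjoint_family_onD[of F' "pverts H" v u] by simp
  qed
  then have KF: "F' v \<inter> pverts (blow_up H F) = {}" by (auto simp: blow_up_def)
  have "replace_by_clique (blow_up H F) v (F' v) = blow_up H (F(v := F' v))"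
    using insert.prems vH KF by (intro replace_by_clique_blow_up) (auto simp: clique_family_def)
  moreover have "expands (blow_up H (F(v := F' v))) S (blow_up H F')"
    using insert.prems insert.hyps K KF by (intro insert.IH clique_family_upd) (auto simp: fun_upd_def)
  moreover have "insert v S - {v} = S" using insert.hyps by auto
  ultimately show ?case by (intro expands.expands_replace[OF _ v K KF]) auto
qed

lemma clique_family_singletons: "clique_family V (\<lambda>v. {v})"
  by (auto simp: clique_family_def disjoint_family_on_def)

lemma expansion_ofD:
  assumes "pair_graph H" "expansion_of E H"
  obtains F where "E = blow_up H F" "clique_family (pverts H) F"
  using expands_blow_upD[OF assms(2)[unfolded expansion_of_def] blow_up_singletons[symmetric] assms(1)]
    assms(1) clique_family_singletons by blast

lemma expansion_ofI:
  assumes "pair_graph H" "clique_family (pverts H) F"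
    "\<And>v. v \<in> pverts H \<Longrightarrow> F v \<inter> pverts H = {}"
  shows "expansion_of (blow_up H F) H"
proof -
  interpret pair_graph H by fact
  have "expands (blow_up H (\<lambda>v. {v})) (pverts H) (blow_up H F)"
    using assms by (intro expands_blow_upI clique_family_singletons) auto
  then show ?thesis by (simp add: expansion_of_def blow_up_singletons assms(1))
qed

subsection \<open>The tournaments with a disconnected niche graph\<close>

text \<open>The partite sets are \<open>A\<close>, \<open>C\<close> and \<open>B \<union> W\<close>,
  which is why no arcs join \<open>B\<close> and \<open>W\<close>. The sets \<open>A\<close>,
  \<open>C\<close>, \<open>W\<close> form a directed triangle, whereas \<open>B\<close> lies between
  \<open>A\<close> and \<open>C\<close>.\<close>

definition triangle_tournament :: "'a set \<Rightarrow> 'a set \<Rightarrow> 'a set \<Rightarrow> 'a set \<Rightarrow> 'a pair_pre_digraph" where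
  "triangle_tournament A B C W = \<lparr> pverts = A \<union> B \<union> C \<union> W,
    parcs = A \<times> C \<union> C \<times> W \<union> W \<times> A \<union> A \<times> B \<union> B \<times> C \<rparr>"

text \<open>\<open>A\<close> and \<open>B\<close> share the out-neighbours in \<open>C\<close>, and
  \<open>B\<close> and \<open>C\<close> share the in-neighbours in \<open>A\<close>; no other two
  classes have a common out- or in-neighbour. The set \<open>B\<close> may be empty, so that the
  degenerate case with three components is covered.\<close>

lemma niche_graph_triangle_tournament:
  assumes "A \<noteq> {}" "C \<noteq> {}" "W \<noteq> {}"
    "A \<inter> B = {}" "A \<inter> C = {}" "A \<inter> W = {}" "B \<inter> C = {}" "B \<inter> W = {}" "C \<inter> W = {}"
  shows "niche_graph (triangle_tournament A B C W) = \<lparr> pverts = A \<union> B \<union> C \<union> W,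
    parcs = {(u, v). u \<noteq> v \<and> (u \<in> A \<union> B \<and> v \<in> A \<union> B \<or> u \<in> B \<union> C \<and> v \<in> B \<union> C \<or> u \<in> W \<and> v \<in> W)} \<rparr>"
proof -
  let ?D = "triangle_tournament A B C W"
  obtain a c w where ne: "a \<in> A" "c \<in> C" "w \<in> W" using assms by blast
  have dis: "x \<in> A \<Longrightarrow> x \<notin> B \<and> x \<notin> C \<and> x \<notin> W" "x \<in> B \<Longrightarrow> x \<notin> C \<and> x \<notin> W" "x \<in> C \<Longrightarrow> x \<notin> W" for x
    using assms by blast+
  have out: "(\<exists>x\<in>pverts ?D. (u, x) \<in> parcs ?D \<and> (v, x) \<in> parcs ?D) \<longleftrightarrow>
    u \<in> A \<union> B \<and> v \<in> A \<union> B \<or> u \<in> C \<and> v \<in> C \<or> u \<in> W \<and> v \<in> W" (is "?L \<longleftrightarrow> ?R") for u v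
  proof
    show "?L \<Longrightarrow> ?R" unfolding triangle_tournament_def by (auto dest: dis)
    assume ?R
    then consider "u \<in> A \<union> B" "v \<in> A \<union> B" | "u \<in> C" "v \<in> C" | "u \<in> W" "v \<in> W" by blast
    then show ?L
      by cases (use ne in \<open>auto simp: triangle_tournament_def\<close>)
  qed
  have inn: "(\<exists>x\<in>pverts ?D. (x, u) \<in> parcs ?D \<and> (x, v) \<in> parcs ?D) \<longleftrightarrow>
    u \<in> A \<and> v \<in> A \<or> u \<in> B \<union> C \<and> v \<in> B \<union> C \<or> u \<in> W \<and> v \<in> W" (is "?L \<longleftrightarrow> ?R") for u v
  proof
    show "?L \<Longrightarrow> ?R" unfolding triangle_tournament_def by (auto dest: dis)
    assume ?R
    then consider "u \<in> A" "v \<in> A" | "u \<in> B \<union> C" "v \<in> B \<union> C" | "u \<in> W" "v \<in> W" by blast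
    then show ?L
      by cases (use ne in \<open>auto simp: triangle_tournament_def\<close>)
  qed
  show ?thesis
    unfolding niche_graph_def out inn by (auto simp: triangle_tournament_def)
qed

lemma partite_tournament_triangle_tournament:
  assumes "finite (A \<union> B \<union> C \<union> W)" "A \<noteq> {}" "C \<noteq> {}" "W \<noteq> {}"
    "A \<inter> B = {}" "A \<inter> C = {}" "A \<inter> W = {}" "B \<inter> C = {}" "B \<inter> W = {}" "C \<inter> W = {}"
  shows "partite_tournament 3 (triangle_tournament A B C W)"
proof -
  let ?V = "A \<union> B \<union> C \<union> W" and ?P = "{A, C, B \<union> W}"
  define H where "H = \<lparr> pverts = ?V, parcs = {(u, v). u \<in> ?V \<and> v \<in> ?V \<and> \<not> (\<exists>X\<in>?P. u \<in> X \<and> v \<in> X)} \<rparr>"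
  have dis: "x \<in> A \<Longrightarrow> x \<notin> B \<and> x \<notin> C \<and> x \<notin> W" "x \<in> B \<Longrightarrow> x \<notin> C \<and> x \<notin> W" "x \<in> C \<Longrightarrow> x \<notin> W" for x
    using assms by blast+
  have fin: "finite (parcs H)" by (rule finite_subset[of _ "?V \<times> ?V"]) (use assms in \<open>auto simp: H_def\<close>)
  have "pair_graph H"
    by unfold_locales (use assms(1) fin in \<open>auto simp: H_def symmetric_def sym_def\<close>)
  moreover have "partition_on (pverts H) ?P"
    using assms by (intro partition_onI) (auto simp: H_def disjnt_def)
  moreover have "A \<noteq> C" "A \<noteq> B \<union> W" "C \<noteq> B \<union> W" using assms by blast+
  then have "card ?P = 3" by simp
  ultimately have "complete_partite 3 H"
    unfolding complete_partite_def by (intro conjI exI[of _ ?P]) (simp_all add: H_def)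
  moreover have "orientation_of (triangle_tournament A B C W) H"
    unfolding orientation_of_def
  proof (intro conjI ballI)
    show "parcs (triangle_tournament A B C W) \<subseteq> parcs H"
      unfolding H_def triangle_tournament_def by (auto dest: dis)
    fix e assume "e \<in> parcs H"
    then show "case e of (u, v) \<Rightarrow> (u, v) \<in> parcs (triangle_tournament A B C W) \<longleftrightarrow>
        (v, u) \<notin> parcs (triangle_tournament A B C W)"
      unfolding H_def triangle_tournament_def by (auto dest: dis)
  qed (simp add: H_def triangle_tournament_def)
  ultimately show ?thesis unfolding partite_tournament_def by blast
qed

section \<open>Two-colourings of tournaments with monochromatic neighbourhoods\<close>

locale two_colored_tournament =
  fixes D :: "'a pair_pre_digraph" and P :: "'a set set" and U W :: "'a set"
  assumes parts: "partition_on (pverts D) P"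
    and arcD: "(u, v) \<in> parcs D \<Longrightarrow> X \<in> P \<Longrightarrow> u \<in> X \<Longrightarrow> v \<notin> X"
    and arc_verts: "(u, v) \<in> parcs D \<Longrightarrow> u \<in> pverts D \<and> v \<in> pverts D"
    and arc_iff: "X \<in> P \<Longrightarrow> u \<in> X \<Longrightarrow> v \<in> pverts D - X \<Longrightarrow> (u, v) \<in> parcs D \<longleftrightarrow> (v, u) \<notin> parcs D"
    and colors: "U \<union> W = pverts D" "U \<inter> W = {}" "U \<noteq> {}" "W \<noteq> {}"
    and out_mono: "(x, u) \<in> parcs D \<Longrightarrow> (x, w) \<in> parcs D \<Longrightarrow> u \<in> U \<longleftrightarrow> w \<in> U"
    and in_mono: "(u, x) \<in> parcs D \<Longrightarrow> (w, x) \<in> parcs D \<Longrightarrow> u \<in> U \<longleftrightarrow> w \<in> U"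
begin

text \<open>On the vertices of \<open>D\<close>, lying in \<open>W\<close> is the negation of lying
  in \<open>U\<close>, so the colours are interchangeable. Hence the case of a part containing
  \<open>W\<close> also settles that of a part containing \<open>U\<close>.\<close>

lemma swap: "two_colored_tournament D P W U"
proof
  have UW: "x \<in> W \<longleftrightarrow> x \<notin> U" if "x \<in> pverts D" for x using colors that by blast
  show "u \<in> W \<longleftrightarrow> w \<in> W" if "(x, u) \<in> parcs D" "(x, w) \<in> parcs D" for x u w
    using out_mono[OF that] UW arc_verts that by blast
  show "u \<in> W \<longleftrightarrow> w \<in> W" if "(u, x) \<in> parcs D" "(w, x) \<in> parcs D" for x u w
    using in_mono[OF that] UW arc_verts that by blast
  show "partition_on (pverts D) P" by (rule parts)
  show "v \<notin> X" if "(u, v) \<in> parcs D" "X \<in> P" "u \<in> X" for u v X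
    using that by (rule arcD)
  show "u \<in> pverts D \<and> v \<in> pverts D" if "(u, v) \<in> parcs D" for u v
    using that by (rule arc_verts)
  show "(u, v) \<in> parcs D \<longleftrightarrow> (v, u) \<notin> parcs D" if "X \<in> P" "u \<in> X" "v \<in> pverts D - X" for u v X
    using that by (rule arc_iff)
  show "W \<union> U = pverts D" "W \<inter> U = {}" "W \<noteq> {}" "U \<noteq> {}"
    using colors by auto
qed

lemma part_subset: "X \<in> P \<Longrightarrow> X \<subseteq> pverts D"
  using parts by (auto simp: partition_on_def)

lemma part_disjoint: "X \<in> P \<Longrightarrow> Y \<in> P \<Longrightarrow> X \<noteq> Y \<Longrightarrow> X \<inter> Y = {}"
  using parts by (auto simp: partition_on_def disjoint_def)

lemma part_nonempty: "X \<in> P \<Longrightarrow> X \<noteq> {}"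
  using parts by (auto simp: partition_on_def)

lemma arc_cases: "X \<in> P \<Longrightarrow> u \<in> X \<Longrightarrow> v \<in> pverts D - X \<Longrightarrow> (u, v) \<in> parcs D \<or> (v, u) \<in> parcs D"
  using arc_iff by blast

text \<open>Quantifying over the parts that contain \<open>v\<close> refers to the part of
  \<open>v\<close> without choosing it. That part is removed from \<open>S\<close> and
  \<open>T\<close> because \<open>v\<close> has no arcs inside it.\<close>

definition from_to :: "'a set \<Rightarrow> 'a \<Rightarrow> 'a set \<Rightarrow> bool" where
  "from_to S v T \<longleftrightarrow> (\<forall>X\<in>P. v \<in> X \<longrightarrow> (\<forall>x\<in>S - X. (x, v) \<in> parcs D) \<and> (\<forall>x\<in>T - X. (v, x) \<in> parcs D))"

text \<open>Take witnesses \<open>u\<close> and \<open>w\<close> of the two colours outside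
  \<open>X\<close>. If \<open>u\<close> sends an arc to \<open>v\<close>, no vertex of
  \<open>W\<close> may do so, hence \<open>v\<close> sends arcs to all of \<open>W - X\<close>. As
  \<open>w\<close> is then an out-neighbour, no vertex of \<open>U\<close> is one. The case of an
  arc from \<open>v\<close> to \<open>u\<close> is dual.\<close>

lemma from_to_cases:
  assumes "X \<in> P" "v \<in> X" "U - X \<noteq> {}" "W - X \<noteq> {}"
  shows "from_to U v W \<or> from_to W v U"
proof -
  have uniq: "Y = X" if "Y \<in> P" "v \<in> Y" for Y using assms part_disjoint that by blast
  have arc: "(v, x) \<in> parcs D \<or> (x, v) \<in> parcs D" if "x \<in> U \<union> W - X" for x
    using arc_cases[OF assms(1,2)] colors that by auto
  have UW: "x \<in> W \<Longrightarrow> x \<notin> U" for x using colors by blast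
  obtain u w where uw: "u \<in> U - X" "w \<in> W - X" using assms by blast
  show ?thesis
  proof (cases "(u, v) \<in> parcs D")
    case True
    have 1: "(v, x) \<in> parcs D" if "x \<in> W - X" for x
      using in_mono[OF True, of x] UW[of x] uw that arc[of x] by auto
    have "(x, v) \<in> parcs D" if "x \<in> U - X" for x
      using out_mono[OF 1[OF uw(2)], of x] UW[of w] uw that arc[of x] by auto
    with 1 show ?thesis unfolding from_to_def using uniq by blast
  next
    case False
    then have vu: "(v, u) \<in> parcs D" using arc uw by blast
    have 1: "(x, v) \<in> parcs D" if "x \<in> W - X" for x
      using out_mono[OF vu, of x] UW[of x] uw that arc[of x] by auto
    have "(v, x) \<in> parcs D" if "x \<in> U - X" for x
      using in_mono[OF 1[OF uw(2)], of x] UW[of w] uw that arc[of x] by auto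
    with 1 show ?thesis unfolding from_to_def using uniq by blast
  qed
qed

text \<open>Say that \<open>v\<close> has a type if it passes from one colour to the other. Of two vertices in different
  parts, equal colours force opposite types and different colours force equal types. The number of
  equally coloured pairs among three vertices is odd, whereas that of pairs of opposite type is even.\<close>

lemma monochromatic_outside:
  assumes "X \<in> P" "Y \<in> P" "Z \<in> P" "X \<noteq> Y" "X \<noteq> Z" "Y \<noteq> Z"
  obtains T where "T \<in> {X, Y, Z}" "U \<subseteq> T \<or> W \<subseteq> T"
proof (rule ccontr)
  assume "\<not> thesis"
  with that have ne: "U - T \<noteq> {}" "W - T \<noteq> {}" if "T \<in> {X, Y, Z}" for T using that by blast+
  obtain x y z where xyz: "x \<in> X" "y \<in> Y" "z \<in> Z" using part_nonempty assms by blast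
  have ft: "from_to U x W \<or> from_to W x U" "from_to U y W \<or> from_to W y U" "from_to U z W \<or> from_to W z U"
    using from_to_cases ne assms xyz by auto
  have dis: "X \<inter> Y = {}" "X \<inter> Z = {}" "Y \<inter> Z = {}" using part_disjoint assms by auto
  \<comment> \<open>Each excluded combination of colours and types would put both
    \<open>(a, b)\<close> and \<open>(b, a)\<close> into \<open>parcs D\<close>.\<close>
  have pairs: "\<not> (a \<in> U \<and> b \<in> U \<or> a \<in> W \<and> b \<in> W) \<or> \<not> (from_to U a W \<and> from_to U b W \<or> from_to W a U \<and> from_to W b U)"
    "\<not> (a \<in> U \<and> b \<in> W \<or> a \<in> W \<and> b \<in> U) \<or> \<not> (from_to U a W \<and> from_to W b U \<or> from_to W a U \<and> from_to U b W)"
    if ab: "A \<in> P" "B \<in> P" "a \<in> A" "b \<in> B" "A \<inter> B = {}" for a b A B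
  proof -
    have ft: "from_to S a T \<Longrightarrow> b \<in> S \<Longrightarrow> (b, a) \<in> parcs D" "from_to S a T \<Longrightarrow> b \<in> T \<Longrightarrow> (a, b) \<in> parcs D"
      "from_to S b T \<Longrightarrow> a \<in> S \<Longrightarrow> (a, b) \<in> parcs D" "from_to S b T \<Longrightarrow> a \<in> T \<Longrightarrow> (b, a) \<in> parcs D"
      for S T using ab unfolding from_to_def by blast+
    have nb: "\<not> ((a, b) \<in> parcs D \<and> (b, a) \<in> parcs D)"
      using arc_iff[OF ab(1,3), of b] ab part_subset by blast
    show "\<not> (a \<in> U \<and> b \<in> U \<or> a \<in> W \<and> b \<in> W) \<or> \<not> (from_to U a W \<and> from_to U b W \<or> from_to W a U \<and> from_to W b U)"
      using ft nb by blast
    show "\<not> (a \<in> U \<and> b \<in> W \<or> a \<in> W \<and> b \<in> U) \<or> \<not> (from_to U a W \<and> from_to W b U \<or> from_to W a U \<and> from_to U b W)"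
      using ft nb by blast
  qed
  have "x \<in> U \<or> x \<in> W" "y \<in> U \<or> y \<in> W" "z \<in> U \<or> z \<in> W"
    using xyz colors part_subset assms by blast+
  then show False
    using ft pairs[OF assms(1,2) xyz(1,2) dis(1)] pairs[OF assms(1,3) xyz(1,3) dis(2)]
      pairs[OF assms(2,3) xyz(2,3) dis(3)] by argo
qed

text \<open>Parts other than \<open>X\<close> miss \<open>W\<close> and hence lie in
  \<open>U\<close>. Given three of them, \<open>monochromatic_outside\<close> yields one that
  contains \<open>U\<close> or \<open>W\<close>. It cannot contain \<open>W\<close>, and if it
  contained \<open>U\<close>, it would contain the other two.\<close>

lemma two_other_parts:
  assumes X: "X \<in> P" "W \<subseteq> X" and "finite P" "card P \<ge> 3"
  obtains Y Z where "P = {X, Y, Z}" "X \<noteq> Y" "X \<noteq> Z" "Y \<noteq> Z"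
proof -
  have "card (P - {X}) \<ge> 2" using assms by simp
  then obtain T where T: "T \<subseteq> P - {X}" "card T = 2" by (metis obtain_subset_with_card_n)
  then obtain Y Z where YZ: "Y \<noteq> Z" "Y \<in> P" "Z \<in> P" "Y \<noteq> X" "Z \<noteq> X"
    by (auto simp: card_2_iff)
  have "T = X" if T: "T \<in> P" "T \<noteq> Y" "T \<noteq> Z" for T
  proof (rule ccontr)
    assume TX: "T \<noteq> X"
    have out: "R \<inter> X = {}" "R \<subseteq> U" "R \<noteq> {}" if R: "R \<in> {T, Y, Z}" for R
    proof -
      have "R \<in> P" "R \<noteq> X" using R T(1) TX YZ by auto
      then show RX: "R \<inter> X = {}" and "R \<noteq> {}" using part_disjoint X(1) part_nonempty by auto
      show "R \<subseteq> U" using part_subset[OF \<open>R \<in> P\<close>] RX X(2) colors(1) by blast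
    qed
    obtain S where S: "S \<in> {T, Y, Z}" "U \<subseteq> S \<or> W \<subseteq> S"
      using monochromatic_outside[OF T(1) YZ(2,3) T(2) T(3) YZ(1)] .
    have "\<not> W \<subseteq> S" using out(1)[OF S(1)] X(2) colors(4) by blast
    then have US: "U \<subseteq> S" using S(2) by blast
    have dis: "T \<inter> Y = {}" "T \<inter> Z = {}" "Y \<inter> Z = {}"
      using part_disjoint T(1) YZ T(2) T(3) by auto
    have sub: "R \<subseteq> S" if "R \<in> {T, Y, Z}" for R
      using out(2)[OF that] US by (rule subset_trans)
    have "T \<subseteq> S" "Y \<subseteq> S" "Z \<subseteq> S" "T \<noteq> {}" "Y \<noteq> {}" by (rule sub out(3), simp)+
    then show False using S(1) dis by blast
  qed
  then have "P = {X, Y, Z}" using X(1) YZ(2,3) by blast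
  then show thesis using YZ by (intro that[of Y Z]) auto
qed

text \<open>\<open>Y\<close> and \<open>Z\<close> lie in \<open>U\<close>, and \<open>W\<close> lies
  in \<open>X\<close>, so every vertex of \<open>Y\<close> and \<open>Z\<close> sees both colours
  outside its part and has a type. The single arc from \<open>y\<close> to \<open>z\<close>
  determines all these types, and the types determine all arcs.\<close>

lemma triangle_aux:
  assumes P: "P = {X, Y, Z}" "X \<noteq> Y" "X \<noteq> Z" "Y \<noteq> Z" and X: "W \<subseteq> X"
    and yz: "y \<in> Y" "z \<in> Z" "(y, z) \<in> parcs D"
  shows "D = triangle_tournament Y (X - W) Z W"
proof -
  have mem: "X \<in> P" "Y \<in> P" "Z \<in> P" using P(1) by simp_all
  have V: "pverts D = X \<union> Y \<union> Z" using parts unfolding P(1) partition_on_def by auto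
  have "X \<inter> Y = {}" "X \<inter> Z = {}" "Y \<inter> Z = {}"
    by (rule part_disjoint; use mem P(2-4) in simp)+
  then have dis: "x \<in> X \<Longrightarrow> x \<notin> Y" "x \<in> X \<Longrightarrow> x \<notin> Z" "x \<in> Y \<Longrightarrow> x \<notin> Z" for x by blast+
  have U: "x \<in> U" if "x \<in> X \<union> Y \<union> Z" "x \<notin> W" for x using that colors(1) V by blast
  have YU: "x \<in> U" if "x \<in> Y" for x using U[of x] that X dis by blast
  have ZU: "x \<in> U" if "x \<in> Z" for x using U[of x] that X dis by blast
  have nb: "(b, a) \<notin> parcs D" if ab: "(a, b) \<in> parcs D" for a b
  proof -
    have v: "a \<in> pverts D" "b \<in> pverts D" using arc_verts[OF ab] by simp_all
    then obtain A where A: "A \<in> P" "a \<in> A" using V mem by blast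
    then have "b \<in> pverts D - A" using arcD[OF ab] v by blast
    then show ?thesis using arc_iff[OF A] ab by blast
  qed
  obtain w where w: "w \<in> W" "w \<in> X" using colors(4) X by blast
  have typY: "from_to U v W \<or> from_to W v U" if "v \<in> Y" for v
  proof (rule from_to_cases[OF mem(2) that])
    show "U - Y \<noteq> {}" using ZU[OF yz(2)] yz(2) dis by blast
    show "W - Y \<noteq> {}" using w dis by blast
  qed
  have typZ: "from_to U v W \<or> from_to W v U" if "v \<in> Z" for v
  proof (rule from_to_cases[OF mem(3) that])
    show "U - Z \<noteq> {}" using YU[OF yz(1)] yz(1) dis by blast
    show "W - Z \<noteq> {}" using w dis by blast
  qed
  have into: "(a, v) \<in> parcs D" if "from_to S v T" "A \<in> P" "v \<in> A" "a \<in> S" "a \<notin> A" for S T v a A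
    using that unfolding from_to_def by blast
  have outof: "(v, a) \<in> parcs D" if "from_to S v T" "A \<in> P" "v \<in> A" "a \<in> T" "a \<notin> A" for S T v a A
    using that unfolding from_to_def by blast
  have notYZ: "y' \<notin> Z" "z' \<notin> Y" if "y' \<in> Y" "z' \<in> Z" for y' z' using that dis by blast+
  \<comment> \<open>With the other type, \<open>y\<close> would receive an arc from
    \<open>z\<close>, which has colour \<open>U\<close>.\<close>
  have y: "from_to W y U"
    using typY[OF yz(1)] into[OF _ mem(2) yz(1) ZU[OF yz(2)]] notYZ[OF yz(1,2)] nb[OF yz(3)] by blast
  \<comment> \<open>The type of \<open>y\<close> orients its arcs to all of \<open>Z\<close> and so
    fixes the types there; the type of \<open>z\<close> then does the same for
    \<open>Y\<close>.\<close>
  have Z: "from_to U v W" if v: "v \<in> Z" for v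
  proof -
    have "(y, v) \<in> parcs D" using outof[OF y mem(2) yz(1) ZU[OF v] notYZ(2)[OF yz(1) v]] .
    then have "\<not> from_to W v U"
      using outof[OF _ mem(3) v YU[OF yz(1)] notYZ(1)[OF yz(1) v]] nb by blast
    then show ?thesis using typZ[OF v] by blast
  qed
  have Y: "from_to W v U" if v: "v \<in> Y" for v
  proof -
    have "(v, z) \<in> parcs D" using into[OF Z[OF yz(2)] mem(3) yz(2) YU[OF v] notYZ(1)[OF v yz(2)]] .
    then have "\<not> from_to U v W"
      using into[OF _ mem(2) v ZU[OF yz(2)] notYZ(2)[OF v yz(2)]] nb by blast
    then show ?thesis using typY[OF v] by blast
  qed
  let ?T = "triangle_tournament Y (X - W) Z W"
  have sub: "parcs ?T \<subseteq> parcs D"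
  proof -
    have "(a, b) \<in> parcs D" if ab: "a \<in> Y" "b \<in> Z" for a b
      using outof[OF Y[OF ab(1)] mem(2) ab(1) ZU[OF ab(2)] notYZ(2)[OF ab]] .
    moreover have "(a, b) \<in> parcs D" if ab: "a \<in> Z" "b \<in> W" for a b
    proof (rule outof[OF Z[OF ab(1)] mem(3) ab])
      show "b \<notin> Z" using ab(2) X dis(2) by blast
    qed
    moreover have "(a, b) \<in> parcs D" if ab: "a \<in> W" "b \<in> Y" for a b
    proof (rule into[OF Y[OF ab(2)] mem(2) ab(2,1)])
      show "a \<notin> Y" using ab(1) X dis(1) by blast
    qed
    moreover have "(a, b) \<in> parcs D" if ab: "a \<in> Y" "b \<in> X - W" for a b
    proof (rule outof[OF Y[OF ab(1)] mem(2) ab(1)])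
      show "b \<in> U" using ab(2) U by blast
      show "b \<notin> Y" using ab(2) dis(1) by blast
    qed
    moreover have "(a, b) \<in> parcs D" if ab: "a \<in> X - W" "b \<in> Z" for a b
    proof (rule into[OF Z[OF ab(2)] mem(3) ab(2)])
      show "a \<in> U" using ab(1) U by blast
      show "a \<notin> Z" using ab(1) dis(2) by blast
    qed
    ultimately show ?thesis by (auto simp: triangle_tournament_def)
  qed
  \<comment> \<open>Vertices in different parts are already joined by an arc of \<open>?T\<close>,
    and \<open>D\<close> contains no opposite pairs of arcs, so \<open>D\<close> has no room for
    further arcs.\<close>
  have "(a, b) \<in> parcs ?T" if ab: "(a, b) \<in> parcs D" for a b
  proof -
    have "a \<in> X \<union> Y \<union> Z" "b \<in> X \<union> Y \<union> Z" using arc_verts[OF ab] V by simp_all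
    moreover have "\<not> (a \<in> X \<and> b \<in> X)" "\<not> (a \<in> Y \<and> b \<in> Y)" "\<not> (a \<in> Z \<and> b \<in> Z)"
      using arcD[OF ab] mem by blast+
    ultimately have "(a, b) \<in> parcs ?T \<or> (b, a) \<in> parcs ?T"
      unfolding triangle_tournament_def by auto
    then show ?thesis using sub nb[OF ab] by blast
  qed
  then have "parcs D = parcs ?T" using sub by auto
  moreover have "pverts D = pverts ?T" using V X by (auto simp: triangle_tournament_def)
  ultimately show ?thesis by (intro pair_pre_digraph.equality) auto
qed

text \<open>The other two parts are named so that some arc runs from \<open>Y\<close> to
  \<open>Z\<close>; otherwise their names are exchanged.\<close>

lemma triangle_if_part_superset:
  assumes "X \<in> P" "W \<subseteq> X" "finite P" "card P \<ge> 3"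
  obtains Y Z where "P = {X, Y, Z}" "X \<noteq> Y" "X \<noteq> Z" "Y \<noteq> Z" "D = triangle_tournament Y (X - W) Z W"
proof -
  obtain Y Z where P: "P = {X, Y, Z}" "X \<noteq> Y" "X \<noteq> Z" "Y \<noteq> Z"
    using two_other_parts[OF assms] .
  have mem: "Y \<in> P" "Z \<in> P" using P(1) by simp_all
  obtain y z where yz: "y \<in> Y" "z \<in> Z" using part_nonempty mem by blast
  have "z \<in> pverts D - Y"
    using part_disjoint[OF mem P(4)] part_subset[OF mem(2)] yz(2) by blast
  then consider "(y, z) \<in> parcs D" | "(z, y) \<in> parcs D" using arc_cases[OF mem(1) yz(1)] by blast
  then show thesis
  proof cases
    case 1
    then show ?thesis using that[OF P triangle_aux[OF P assms(2) yz]] by simp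
  next
    case 2
    have P': "P = {X, Z, Y}" using P(1) by auto
    show ?thesis
      using that[OF P' P(3,2) P(4)[symmetric] triangle_aux[OF P' P(3,2) P(4)[symmetric] assms(2) yz(2,1) 2]] .
  qed
qed

end

text \<open>Any three parts include one that contains a colour class. \<open>S\<close> is that class
  and \<open>B\<close> is the rest of its part, which may be empty at this stage.\<close>

lemma two_colored_tournament_triangle:
  assumes "two_colored_tournament D P U W" "finite P" "card P \<ge> 3"
  obtains A B C S where "D = triangle_tournament A B C S" "card P = 3"
    "A \<noteq> {}" "C \<noteq> {}" "S \<noteq> {}"
    "A \<inter> B = {}" "A \<inter> C = {}" "A \<inter> S = {}" "B \<inter> C = {}" "B \<inter> S = {}" "C \<inter> S = {}"
proof -
  interpret two_colored_tournament D P U W by fact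
  interpret sw: two_colored_tournament D P W U by (rule swap)
  obtain T where T: "T \<subseteq> P" "card T = 3" "finite T" using assms(3) obtain_subset_with_card_n by metis
  then obtain X1 X2 X3 where T3: "T = {X1, X2, X3}" "X1 \<noteq> X2" "X1 \<noteq> X3" "X2 \<noteq> X3"
    unfolding card_3_iff by blast
  then have mem: "X1 \<in> P" "X2 \<in> P" "X3 \<in> P" using T(1) by simp_all
  obtain X where "X \<in> {X1, X2, X3}" "U \<subseteq> X \<or> W \<subseteq> X"
    using monochromatic_outside[OF mem T3(2-4)] .
  then have X: "X \<in> P" "U \<subseteq> X \<or> W \<subseteq> X" using mem by auto
  then obtain S Y Z where S: "S \<noteq> {}" "S \<subseteq> X" and P: "P = {X, Y, Z}" "X \<noteq> Y" "X \<noteq> Z" "Y \<noteq> Z"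
    and D: "D = triangle_tournament Y (X - S) Z S"
    using triangle_if_part_superset[OF X(1) _ assms(2,3)] sw.triangle_if_part_superset[OF X(1) _ assms(2,3)]
      colors(3,4) by metis
  have "X \<inter> Y = {}" "X \<inter> Z = {}" "Y \<inter> Z = {}" using part_disjoint P by auto
  moreover have "Y \<noteq> {}" "Z \<noteq> {}" using part_nonempty P by auto
  moreover have "card P = 3" using P by simp
  ultimately show thesis using S D by (intro that[of Y "X - S" Z S]) auto
qed

section \<open>Tournaments whose niche graph has two components\<close>

lemma pair_graph_niche_graph:
  assumes "finite (pverts D)"
  shows "pair_graph (niche_graph D)"
proof -
  have "finite (parcs (niche_graph D))"
    by (rule finite_subset[of _ "pverts D \<times> pverts D"]) (use assms in \<open>auto simp: niche_graph_def\<close>)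
  then show ?thesis
    by unfold_locales (use assms in \<open>auto simp: niche_graph_def symmetric_def sym_def\<close>)
qed

lemma finite_partite_tournament:
  assumes "partite_tournament k D"
  shows "finite (pverts D)"
proof -
  obtain H where H: "pair_graph H" "pverts D = pverts H"
    using assms unfolding partite_tournament_def complete_partite_def orientation_of_def by blast
  interpret pair_graph H by (rule H(1))
  show ?thesis using pair_finite_verts H(2) by simp
qed

text \<open>Two distinct vertices with a common out- or in-neighbour are adjacent in the niche
  graph, hence in one component. So the components give a colouring with monochromatic
  neighbourhoods, and counting them excludes an empty \<open>B\<close>.\<close>

lemma partite_tournament_two_components:
  assumes "partite_tournament k D" "k \<ge> 3" "card (components (niche_graph D)) = 2"
  obtains A B C S where "D = triangle_tournament A B C S" "k = 3"
    "finite (A \<union> B \<union> C \<union> S)" "A \<noteq> {}" "B \<noteq> {}" "C \<noteq> {}" "S \<noteq> {}"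
    "A \<inter> B = {}" "A \<inter> C = {}" "A \<inter> S = {}" "B \<inter> C = {}" "B \<inter> S = {}" "C \<inter> S = {}"
proof -
  obtain H where H0: "complete_partite k H" "orientation_of D H"
    using assms(1) unfolding partite_tournament_def by blast
  from H0(1) obtain P where P: "partition_on (pverts H) P" "card P = k"
    and H: "parcs H = {(u, v). u \<in> pverts H \<and> v \<in> pverts H \<and> \<not> (\<exists>X\<in>P. u \<in> X \<and> v \<in> X)}"
    unfolding complete_partite_def by blast
  have or: "pverts D = pverts H" "parcs D \<subseteq> parcs H"
      "\<And>u v. (u, v) \<in> parcs H \<Longrightarrow> (u, v) \<in> parcs D \<longleftrightarrow> (v, u) \<notin> parcs D"
    using H0(2) unfolding orientation_of_def by auto
  have fin: "finite (pverts D)" using assms(1) by (rule finite_partite_tournament)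
  have N: "pair_graph (niche_graph D)" using fin by (rule pair_graph_niche_graph)
  obtain U W where UW: "U \<union> W = pverts D" "U \<inter> W = {}" "U \<noteq> {}" "W \<noteq> {}"
    and cl: "\<And>u v. (u, v) \<in> parcs (niche_graph D) \<Longrightarrow> u \<in> U \<longleftrightarrow> v \<in> U"
    using two_components_split[OF N assms(3)] by (auto simp: niche_graph_def)
  have av: "u \<in> pverts D \<and> v \<in> pverts D" if "(u, v) \<in> parcs D" for u v
    using that or H by auto
  have tct: "two_colored_tournament D P U W"
  proof
    show "u \<in> U \<longleftrightarrow> w \<in> U" if "(x, u) \<in> parcs D" "(x, w) \<in> parcs D" for x u w
      using cl[of u w] that av by (cases "u = w") (auto simp: niche_graph_def)
    show "u \<in> U \<longleftrightarrow> w \<in> U" if "(u, x) \<in> parcs D" "(w, x) \<in> parcs D" for x u w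
      using cl[of u w] that av by (cases "u = w") (auto simp: niche_graph_def)
    show "partition_on (pverts D) P" using P or by simp
    show "v \<notin> X" if "(u, v) \<in> parcs D" "X \<in> P" "u \<in> X" for u v X
      using that or(2) H by auto
    show "(u, v) \<in> parcs D \<longleftrightarrow> (v, u) \<notin> parcs D" if "X \<in> P" "u \<in> X" "v \<in> pverts D - X" for u v X
    proof (rule or(3))
      have "\<not> (\<exists>Y\<in>P. u \<in> Y \<and> v \<in> Y)"
        using P(1) that by (auto simp: partition_on_def disjoint_def)
      moreover have "u \<in> pverts H" using P(1) that by (auto simp: partition_on_def)
      ultimately show "(u, v) \<in> parcs H" using that or H by auto
    qed
  qed (use av UW in auto)
  have "finite P" using P(2) assms(2) by (intro card_ge_0_finite) simp
  then obtain A B C S where D: "D = triangle_tournament A B C S" and k: "card P = 3"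
    and ne: "A \<noteq> {}" "C \<noteq> {}" "S \<noteq> {}" and dis: "A \<inter> B = {}" "A \<inter> C = {}" "A \<inter> S = {}"
      "B \<inter> C = {}" "B \<inter> S = {}" "C \<inter> S = {}"
    using two_colored_tournament_triangle[OF tct _ assms(2)[folded P(2)]] by blast
  \<comment> \<open>Without \<open>B\<close> nothing links \<open>A\<close> and \<open>C\<close> in
    the niche graph, and \<open>A\<close>, \<open>C\<close>, \<open>S\<close> are three classes
    closed under adjacency.\<close>
  have "B \<noteq> {}"
  proof
    assume B: "B = {}"
    have NG: "niche_graph D = \<lparr> pverts = A \<union> B \<union> C \<union> S,
      parcs = {(u, v). u \<noteq> v \<and> (u \<in> A \<union> B \<and> v \<in> A \<union> B \<or> u \<in> B \<union> C \<and> v \<in> B \<union> C \<or> u \<in> S \<and> v \<in> S)} \<rparr>"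
      unfolding D using ne dis by (rule niche_graph_triangle_tournament)
    have "card {A, C, S} \<le> card (components (niche_graph D))"
    proof (rule card_closed_partition_le[OF N])
      show "partition_on (pverts (niche_graph D)) {A, C, S}"
        unfolding NG using ne dis B by (intro partition_onI) (auto simp: disjnt_def)
    qed (use dis in \<open>auto simp: NG B\<close>)
    moreover have "A \<noteq> C" "A \<noteq> S" "C \<noteq> S" using ne dis by auto
    then have "card {A, C, S} = 3" by simp
    ultimately show False using assms(3) by simp
  qed
  have "finite (A \<union> B \<union> C \<union> S)" using fin D by (simp add: triangle_tournament_def)
  then show thesis using D k[unfolded P(2)] ne \<open>B \<noteq> {}\<close> dis by (intro that[of A B C S]) simp_all
qed

subsection \<open>Expansions of the path with an isolated vertex\<close>

lemma pair_graph_P3_union_K1: "pair_graph P3_union_K1"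
  by unfold_locales (auto simp: P3_union_K1_def symmetric_def sym_def)

lemma clique_family_P3_union_K1:
  "clique_family (pverts P3_union_K1) F \<longleftrightarrow>
    finite (F 0 \<union> F 1 \<union> F 2 \<union> F 3) \<and> F 0 \<noteq> {} \<and> F 1 \<noteq> {} \<and> F 2 \<noteq> {} \<and> F 3 \<noteq> {} \<and>
    F 0 \<inter> F 1 = {} \<and> F 0 \<inter> F 2 = {} \<and> F 0 \<inter> F 3 = {} \<and> F 1 \<inter> F 2 = {} \<and> F 1 \<inter> F 3 = {} \<and> F 2 \<inter> F 3 = {}"
  by (auto simp: clique_family_def disjoint_family_on_def P3_union_K1_def)

text \<open>The classes \<open>A\<close>, \<open>B\<close>, \<open>C\<close> take the places of the
  path \<open>0\<close>, \<open>1\<close>, \<open>2\<close>, and \<open>W\<close> that of the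
  isolated vertex \<open>3\<close>. Both directions of the theorem rest on this identity.\<close>

lemma niche_graph_triangle_eq_blow_up:
  assumes "clique_family (pverts P3_union_K1) F"
  shows "niche_graph (triangle_tournament (F 0) (F 1) (F 2) (F 3)) = blow_up P3_union_K1 F"
proof -
  have "blow_up P3_union_K1 F = \<lparr> pverts = F 0 \<union> F 1 \<union> F 2 \<union> F 3,
    parcs = {(u, v). u \<noteq> v \<and> (u \<in> F 0 \<union> F 1 \<and> v \<in> F 0 \<union> F 1 \<or>
      u \<in> F 1 \<union> F 2 \<and> v \<in> F 1 \<union> F 2 \<or> u \<in> F 3 \<and> v \<in> F 3)} \<rparr>"
    by (auto simp: blow_up_def P3_union_K1_def)
  then show ?thesis
    using assms unfolding clique_family_P3_union_K1
    by (subst niche_graph_triangle_tournament) auto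
qed

text \<open>Used to rename the vertices of the cliques so that they avoid the vertices of
  \<open>H\<close>, as \<open>expansion_ofI\<close> demands.\<close>

lemma digraph_iso_blow_up_image:
  assumes "pair_wf_digraph H" "inj f"
  shows "digraph_iso (with_proj (blow_up H F)) (with_proj (blow_up H (\<lambda>v. f ` F v)))"
proof -
  have wf: "pair_wf_digraph (blow_up H G)" for G :: "'a \<Rightarrow> 'c set"
    by unfold_locales (auto simp: blow_up_def)
  have wf': "pair_wf_digraph (blow_up H F)"
    by unfold_locales (auto simp: blow_up_def)
  have "bij_betw f (pverts (blow_up H F)) (pverts (blow_up H (\<lambda>v. f ` F v)))"
    using assms(2) by (auto simp: bij_betw_def blow_up_def inj_on_def)
  moreover have "(u, v) \<in> parcs (blow_up H F) \<longleftrightarrow> (f u, f v) \<in> parcs (blow_up H (\<lambda>v. f ` F v))" for u v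
    using assms(2) by (simp add: blow_up_def inj_image_mem_iff inj_eq)
  ultimately show ?thesis
    unfolding digraph_iso_pair_iff[OF wf' wf] by blast
qed

theorem theorem3p8:
  fixes G :: "'a pair_pre_digraph" and k :: nat
  assumes "pair_graph G"
    and "card (components G) = 2"
    and "k \<ge> 3"
  shows "niche_realizable G k \<longleftrightarrow>
    k = 3 \<and> (\<exists>E. expansion_of E P3_union_K1 \<and> digraph_iso (with_proj G) (with_proj E))"
proof
  assume "niche_realizable G k"
  then obtain D :: "nat pair_pre_digraph" where D: "partite_tournament k D"
    and iso: "digraph_iso (with_proj G) (with_proj (niche_graph D))"
    unfolding niche_realizable_def by blast
  have "finite (pverts D)" using D by (rule finite_partite_tournament)
  then have card: "card (components (niche_graph D)) = 2"
    using card_components_iso[OF assms(1) pair_graph_niche_graph iso] assms(2) by simp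
  obtain A B C S where T: "D = triangle_tournament A B C S" and k: "k = 3" and fam:
    "finite (A \<union> B \<union> C \<union> S)" "A \<noteq> {}" "B \<noteq> {}" "C \<noteq> {}" "S \<noteq> {}"
    "A \<inter> B = {}" "A \<inter> C = {}" "A \<inter> S = {}" "B \<inter> C = {}" "B \<inter> S = {}" "C \<inter> S = {}"
    using partite_tournament_two_components[OF D assms(3) card] .
  define F :: "nat \<Rightarrow> nat set" where "F = (\<lambda>_. {})(0 := A, 1 := B, 2 := C, 3 := S)"
  have F: "F 0 = A" "F 1 = B" "F 2 = C" "F 3 = S" by (auto simp: F_def)
  have cf: "clique_family (pverts P3_union_K1) F"
    unfolding clique_family_P3_union_K1 F using fam by blast
  have N: "niche_graph D = blow_up P3_union_K1 F"
    using niche_graph_triangle_eq_blow_up[OF cf] T F by simp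
  \<comment> \<open>The replacing cliques must avoid the vertices still to be replaced, so they are shifted away from 0, ..., 3.\<close>
  let ?E = "blow_up P3_union_K1 (\<lambda>v. (+) 4 ` F v)"
  have "clique_family (pverts P3_union_K1) (\<lambda>v. (+) 4 ` F v)"
    using cf by (rule clique_family_image) simp
  then have "expansion_of ?E P3_union_K1"
    by (intro expansion_ofI pair_graph_P3_union_K1) (auto simp: P3_union_K1_def)
  moreover have "pair_wf_digraph P3_union_K1"
    using pair_graph_P3_union_K1 by (simp add: pair_graph_def pair_digraph_def pair_fin_digraph_def)
  then have "digraph_iso (with_proj (niche_graph D)) (with_proj ?E)"
    unfolding N by (rule digraph_iso_blow_up_image) simp
  then have "digraph_iso (with_proj G) (with_proj ?E)"
    using iso digraph_iso_trans by blast
  ultimately show "k = 3 \<and> (\<exists>E. expansion_of E P3_union_K1 \<and> digraph_iso (with_proj G) (with_proj E))"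
    using k by blast
next
  assume "k = 3 \<and> (\<exists>E. expansion_of E P3_union_K1 \<and> digraph_iso (with_proj G) (with_proj E))"
  then obtain E where k: "k = 3" and E: "expansion_of E P3_union_K1"
    and iso: "digraph_iso (with_proj G) (with_proj E)" by blast
  obtain F where EF: "E = blow_up P3_union_K1 F" and cf: "clique_family (pverts P3_union_K1) F"
    using expansion_ofD[OF pair_graph_P3_union_K1 E] .
  \<comment> \<open>Cliques replacing vertices of \<open>P3_union_K1\<close> consist of natural
    numbers, so this tournament has the vertex type that \<open>niche_realizable\<close> asks
    for.\<close>
  have "partite_tournament 3 (triangle_tournament (F 0) (F 1) (F 2) (F 3))"
    using cf unfolding clique_family_P3_union_K1
    by (intro partite_tournament_triangle_tournament) auto
  then show "niche_realizable G k"
    using iso k niche_graph_triangle_eq_blow_up[OF cf] EF unfolding niche_realizable_def by metis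
qed

end
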